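(* Let $X$ be a Banach space and let $\mathcal{U}=\{U(t,s)\}_{t\ge s\ge 0}$ be a nonuniform exponentially bounded evolution family on $X$. The following conditions are equivalent: (i) $\mathcal{U}$ is nonuniformly stable; (ii) there exists $\alpha\in\mathcal{A}(\mathcal{U})$ such that $\Phi(t)\,\mathcal{C}_b(\mathcal{U},\alpha)\subset\mathcal{C}_b(\mathcal{U},\alpha)$ for every $t\ge 0$; (iii) there exists $\alpha\in\mathcal{A}(\mathcal{U})$ such that $\Phi(t)\,C_c(\mathbb{R}_+,X)\subset\mathcal{C}_b(\mathcal{U},\alpha)$ for every $t\ge 0$.
   Context: $X$ is a Banach space, $\mathcal{L}(X)$ is the algebra of bounded linear operators on $X$, and $\mathbb{R}_+=[0,\infty)$. $C(\mathbb{R}_+,X)$ is the space of all continuous functions $u:\mathbb{R}_+\to X$; $C_c(\mathbb{R}_+,X)$ is the set of those with compact support. An evolution family is a family $\mathcal{U}=\{U(t,s)\}_{t\ge s\ge 0}$ in $\mathcal{L}(X)$ such that $U(t,t)=\mathrm{Id}$ for $t\ge 0$; $U(t,\tau)U(\tau,s)=U(t,s)$ for $t\ge\tau\ge s\ge 0$; and for each $x\in X$ the map $(t,s)\mapsto U(t,s)x$ is continuous on $\{(t,s)\in\mathbb{R}_+^2: t\ge s\}$. A number $\alpha\in\mathbb{R}$ is an admissible exponent for $\mathcal{U}$ if there is a continuous function $M:\mathbb{R}_+\to(0,\infty)$ with $\|U(t,s)\|\le M(s)e^{\alpha(t-s)}$ for all $t\ge s\ge 0$. $\mathcal{A}(\mathcal{U})$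 is the set of all admissible exponents. $\mathcal{U}$ is nonuniform exponentially bounded if $\mathcal{A}(\mathcal{U})\ne\emptyset$ and nonuniformly stable if $0\in\mathcal{A}(\mathcal{U})$. For $\alpha\in\mathcal{A}(\mathcal{U})$, $t\ge 0$, $u\in C(\mathbb{R}_+,X)$, set $\varphi_\alpha(t,u)=\sup_{\tau\ge t}e^{-\alpha(\tau-t)}\|U(\tau,t)u(t)\|$, and let $\mathcal{C}_b(\mathcal{U},\alpha)=\{u\in C(\mathbb{R}_+,X):\sup_{t\ge 0}\varphi_\alpha(t,u)<\infty\}$, with norm $\|u\|_\alpha=\sup_{t\ge 0}\varphi_\alpha(t,u)$. For $t\ge 0$ the operator $\Phi(t):C(\mathbb{R}_+,X)\to C(\mathbb{R}_+,X)$ is defined by $(\Phi(t)u)(\xi)=U(\xi,t)u(t)$ for $\xi\ge t$ and $(\Phi(t)u)(\xi)=u(\xi)$ for $0\le\xi<t$. *)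

theory Defs
  imports "HOL-Analysis.Analysis"
begin

text \<open>
  A two-parameter family is a function \<open>U\<close> on all of \<open>real \<times> real\<close>, and a function on the
  half-line is a function on all of \<open>real\<close>. Only the values \<open>U t s\<close> with \<open>t \<ge> s \<ge> 0\<close> and
  \<open>u t\<close> with \<open>t \<ge> 0\<close> are ever constrained or used; the others are arbitrary.
\<close>

definition evolution_family :: "(real \<Rightarrow> real \<Rightarrow> 'a::banach \<Rightarrow>\<^sub>L 'a) \<Rightarrow> bool" where
  "evolution_family U \<longleftrightarrow>
     (\<forall>t\<ge>0. U t t = id_blinfun) \<and>
     (\<forall>t \<tau> s. t \<ge> \<tau> \<and> \<tau> \<ge> s \<and> s \<ge> 0 \<longrightarrow> U t \<tau> o\<^sub>L U \<tau> s = U t s) \<and>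
     (\<forall>x. continuous_on {(t, s). t \<ge> s \<and> s \<ge> 0} (\<lambda>(t, s). blinfun_apply (U t s) x))"

definition admissible_exponents :: "(real \<Rightarrow> real \<Rightarrow> 'a::banach \<Rightarrow>\<^sub>L 'a) \<Rightarrow> real set" where
  "admissible_exponents U =
     {\<alpha>. \<exists>M :: real \<Rightarrow> real. continuous_on {0..} M \<and> (\<forall>s\<ge>0. M s > 0) \<and>
           (\<forall>t s. t \<ge> s \<and> s \<ge> 0 \<longrightarrow> norm (U t s) \<le> M s * exp (\<alpha> * (t - s)))}"

definition nonuniform_exp_bounded :: "(real \<Rightarrow> real \<Rightarrow> 'a::banach \<Rightarrow>\<^sub>L 'a) \<Rightarrow> bool" where
  "nonuniform_exp_bounded U \<longleftrightarrow> admissible_exponents U \<noteq> {}"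

definition nonuniformly_stable :: "(real \<Rightarrow> real \<Rightarrow> 'a::banach \<Rightarrow>\<^sub>L 'a) \<Rightarrow> bool" where
  "nonuniformly_stable U \<longleftrightarrow> 0 \<in> admissible_exponents U"

definition cont_halfline :: "(real \<Rightarrow> 'a::banach) set" where
  "cont_halfline = {u. continuous_on {0..} u}"

definition cont_compact_support :: "(real \<Rightarrow> 'a::banach) set" where
  "cont_compact_support = {u \<in> cont_halfline. compact (closure (support_on {0..} u))}"

text \<open>The suprema are taken in the extended reals, so that finiteness is a genuine condition.\<close>

definition phi :: "(real \<Rightarrow> real \<Rightarrow> 'a::banach \<Rightarrow>\<^sub>L 'a) \<Rightarrow> real \<Rightarrow> real \<Rightarrow> (real \<Rightarrow> 'a) \<Rightarrow> ereal" where
  "phi U \<alpha> t u =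
     (SUP \<tau>\<in>{t..}. ereal (exp (- \<alpha> * (\<tau> - t)) * norm (blinfun_apply (U \<tau> t) (u t))))"

definition norm_alpha :: "(real \<Rightarrow> real \<Rightarrow> 'a::banach \<Rightarrow>\<^sub>L 'a) \<Rightarrow> real \<Rightarrow> (real \<Rightarrow> 'a) \<Rightarrow> ereal" where
  "norm_alpha U \<alpha> u = (SUP t\<in>{0..}. phi U \<alpha> t u)"

definition C_b :: "(real \<Rightarrow> real \<Rightarrow> 'a::banach \<Rightarrow>\<^sub>L 'a) \<Rightarrow> real \<Rightarrow> (real \<Rightarrow> 'a) set" where
  "C_b U \<alpha> = {u \<in> cont_halfline. norm_alpha U \<alpha> u < \<infinity>}"

definition Phi :: "(real \<Rightarrow> real \<Rightarrow> 'a::banach \<Rightarrow>\<^sub>L 'a) \<Rightarrow> real \<Rightarrow> (real \<Rightarrow> 'a) \<Rightarrow> real \<Rightarrow> 'a" where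
  "Phi U t u = (\<lambda>\<xi>. if \<xi> \<ge> t then blinfun_apply (U \<xi> t) (u t) else u \<xi>)"

end

theory Submission
  imports Defs
begin

text \<open>
  If \<open>U\<close> is nonuniformly stable, then \<open>\<alpha> = 0\<close> works in both (ii) and (iii). Conversely, (ii)
  implies (iii) for the same \<open>\<alpha>\<close>, because compactly supported functions lie in every
  \<open>C_b U \<alpha>\<close>. Under (iii), choose \<open>u\<close> with compact support and \<open>u s = x\<close>: the terms \<open>\<tau> = t\<close> in
  the suprema defining the norm of \<open>Phi U s u\<close> bound the orbit \<open>U t s x\<close>, \<open>t \<ge> s\<close>. The uniform
  boundedness principle then bounds \<open>U t n\<close> uniformly in \<open>t \<ge> n\<close> for each integer \<open>n\<close>, and the
  exponential bound transfers this to \<open>s \<in> [n - 1, n]\<close> at the cost of a continuous factor.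
\<close>

section \<open>Uniform boundedness and continuous majorants\<close>

text \<open>The sets \<open>F n\<close> are closed and exhaust the space, so by Baire's theorem one
  of them contains a ball. Linearity carries the bound on this ball over to a ball around 0.\<close>

theorem banach_steinhaus:
  fixes T :: "'i \<Rightarrow> 'a::banach \<Rightarrow>\<^sub>L 'b::real_normed_vector"
  assumes "\<And>x. \<exists>B. \<forall>i\<in>I. norm (T i x) \<le> B"
  obtains K where "K \<ge> 0" "\<And>i. i \<in> I \<Longrightarrow> norm (T i) \<le> K"
proof -
  define F where "F n = {x. \<forall>i\<in>I. norm (T i x) \<le> real n}" for n
  have closed_F: "closed (F n)" for n
  proof -
    have "F n = (\<Inter>i\<in>I. {x. norm (T i x) \<le> real n})"
      by (auto simp: F_def)
    moreover have "closed {x. norm (T i x) \<le> real n}" for i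
      by (intro closed_Collect_le continuous_intros)
    ultimately show ?thesis
      by auto
  qed
  have cover: "(\<Union>n. F n) = UNIV"
  proof -
    have "\<exists>n. x \<in> F n" for x
    proof -
      obtain B where B: "\<forall>i\<in>I. norm (T i x) \<le> B"
        using assms by blast
      obtain n where "B \<le> real n"
        using real_arch_simple by blast
      with B show ?thesis
        unfolding F_def by (blast intro: order_trans)
    qed
    then show ?thesis by blast
  qed
  have "\<exists>n. interior (F n) \<noteq> {}"
  proof (rule ccontr)
    assume "\<not> (\<exists>n. interior (F n) \<noteq> {})"
    then have "closedin euclidean (F n) \<and> euclidean interior_of F n = {}" for n
      using closed_F by (auto simp flip: closed_closedin)
    then have "T \<in> range F \<Longrightarrow> closedin euclidean T \<and> euclidean interior_of T = {}" for T
      by (metis imageE)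
    moreover have "completely_metrizable_space (euclidean :: 'a topology)"
      by (rule completely_metrizable_space_euclidean)
    ultimately have "euclidean interior_of \<Union>(range F) = {}"
      using Baire_category_alt[of euclidean "range F"] by simp
    then show False
      by (simp add: cover)
  qed
  then obtain n x where "x \<in> interior (F n)"
    by blast
  then obtain r where r: "r > 0" "cball x r \<subseteq> F n"
    by (meson mem_interior_cball)
  \<comment> \<open>A vector \<open>z\<close> of norm \<open>r\<close> is the difference of
    \<open>x + z\<close> and \<open>x\<close>, two points of \<open>cball x r\<close> at which
    \<open>T i\<close> has norm at most \<open>n\<close>. This gives 2n at radius
    \<open>r\<close>.\<close>
  have bound: "norm (T i) \<le> 2 * real n / r" if i: "i \<in> I" for i
  proof (rule norm_blinfun_bound)
    show "0 \<le> 2 * real n / r"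
      using r by simp
    fix y
    show "norm (T i y) \<le> 2 * real n / r * norm y"
    proof (cases "y = 0")
      case False
      define z where "z = (r / norm y) *\<^sub>R y"
      have "x + z \<in> cball x r" "x \<in> cball x r"
        using r False by (auto simp: z_def dist_norm)
      then have "x + z \<in> F n" "x \<in> F n"
        using r(2) by blast+
      then have le: "norm (T i (x + z)) \<le> real n" "norm (T i x) \<le> real n"
        using i by (auto simp: F_def)
      have "(r / norm y) * norm (T i y) = norm (T i z)"
        using r by (simp add: z_def blinfun.scaleR_right)
      also have "T i z = T i (x + z) - T i x"
        by (simp add: blinfun.add_right)
      also have "norm \<dots> \<le> 2 * real n"
        using norm_triangle_ineq4[of "T i (x + z)" "T i x"] le by linarith
      finally show ?thesis
        using r False by (simp add: field_simps)
    qed simp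
  qed
  show thesis
    using that[of "2 * real n / r"] bound r by simp
qed

lemma continuous_on_compact_bounded_above:
  fixes f :: "'a::topological_space \<Rightarrow> real"
  assumes "compact S" "continuous_on S f"
  obtains B where "\<And>x. x \<in> S \<Longrightarrow> f x \<le> B"
proof (cases "S = {}")
  case False
  then show thesis
    using continuous_attains_sup[OF assms(1) _ assms(2)] that by blast
qed (use that in blast)

text \<open>Take a sum of ramps, the n-th starting at n - 1 and reaching \<open>c n\<close> at n.
  The sum is locally finite, hence continuous, and at s the ramp indexed by the floor of s is
  already high enough.\<close>

lemma continuous_above_step_function:
  fixes c :: "nat \<Rightarrow> real"
  assumes "\<And>n. c n \<ge> 0"
  shows "\<exists>g :: real \<Rightarrow> real. continuous_on {0..} g \<and> (\<forall>s\<ge>0. c (nat \<lfloor>s\<rfloor>) \<le> g s)"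
proof -
  define h where "h n s = c n * max 0 (s - real n + 1)" for n s
  define g where "g s = (\<Sum>n<nat \<lfloor>s\<rfloor> + 2. h n s)" for s
  \<comment> \<open>Ramps with n \<ge> s + 1 vanish at s, so the number of summands, which jumps
    with the floor of s, may be replaced by any larger N.\<close>
  have g_eq: "g s = (\<Sum>n<N. h n s)" if "0 \<le> s" "s + 1 < real N" for s N
    unfolding g_def
  proof (rule sum.mono_neutral_left)
    show "{..<nat \<lfloor>s\<rfloor> + 2} \<subseteq> {..<N}"
      using that by (auto, linarith)
    show "\<forall>n\<in>{..<N} - {..<nat \<lfloor>s\<rfloor> + 2}. h n s = 0"
    proof
      fix n assume "n \<in> {..<N} - {..<nat \<lfloor>s\<rfloor> + 2}"
      then have "s - real n + 1 \<le> 0"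
        using that by (simp, linarith)
      then show "h n s = 0"
        by (simp add: h_def)
    qed
  qed simp
  show ?thesis
  proof (intro exI conjI allI impI)
    show "continuous_on {0..} g"
      unfolding continuous_on_eq_continuous_within
    proof
      fix x :: real assume x: "x \<in> {0..}"
      \<comment> \<open>The margin 2 lets one N serve all s within distance 1 of x, so
        \<open>g\<close> is a fixed finite sum near x.\<close>
      obtain N where N: "x + 2 < real N"
        using reals_Archimedean2 by blast
      have "continuous (at x within {0..}) (\<lambda>s. \<Sum>n<N. h n s)"
        unfolding h_def by (intro continuous_intros)
      then show "continuous (at x within {0..}) g"
        by (rule continuous_transform_within[of _ _ _ 1])
          (use x N in \<open>auto simp: dist_real_def intro!: g_eq[symmetric]\<close>)
    qed
    fix s :: real assume s: "s \<ge> 0"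
    have "c (nat \<lfloor>s\<rfloor>) * 1 \<le> h (nat \<lfloor>s\<rfloor>) s"
      unfolding h_def using s assms by (intro mult_left_mono) (auto simp: max_def)
    also have "\<dots> \<le> g s"
      unfolding g_def using assms by (intro member_le_sum) (auto simp: h_def)
    finally show "c (nat \<lfloor>s\<rfloor>) \<le> g s" by simp
  qed
qed

section \<open>Evolution families and the spaces \<open>C_b\<close>\<close>

lemma evolution_family_id: "evolution_family U \<Longrightarrow> t \<ge> 0 \<Longrightarrow> U t t x = x"
  by (simp add: evolution_family_def)

lemma evolution_family_compose:
  "evolution_family U \<Longrightarrow> t \<ge> \<tau> \<Longrightarrow> \<tau> \<ge> s \<Longrightarrow> s \<ge> 0 \<Longrightarrow> U t \<tau> o\<^sub>L U \<tau> s = U t s"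
  by (auto simp: evolution_family_def)

lemma evolution_family_apply:
  "evolution_family U \<Longrightarrow> t \<ge> \<tau> \<Longrightarrow> \<tau> \<ge> s \<Longrightarrow> s \<ge> 0 \<Longrightarrow> U t \<tau> (U \<tau> s x) = U t s x"
  by (simp flip: blinfun_apply_blinfun_compose add: evolution_family_compose)

text \<open>Trades the nested extended-real suprema for one real constant, uniform in both times;
  all later membership arguments use this form.\<close>

lemma C_b_iff:
  "u \<in> C_b U \<alpha> \<longleftrightarrow> u \<in> cont_halfline \<and>
     (\<exists>K. \<forall>t\<ge>0. \<forall>\<tau>\<ge>t. exp (- \<alpha> * (\<tau> - t)) * norm (U \<tau> t (u t)) \<le> K)"
proof -
  have "norm_alpha U \<alpha> u < \<infinity> \<longleftrightarrow> (\<exists>K. norm_alpha U \<alpha> u \<le> ereal K)"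
    by (cases "norm_alpha U \<alpha> u") auto
  also have "\<dots> \<longleftrightarrow> (\<exists>K. \<forall>t\<ge>0. \<forall>\<tau>\<ge>t. exp (- \<alpha> * (\<tau> - t)) * norm (U \<tau> t (u t)) \<le> K)"
    by (simp add: norm_alpha_def phi_def SUP_le_iff Ball_def)
  finally show ?thesis
    by (simp add: C_b_def)
qed

lemma Phi_cont_halfline:
  assumes U: "evolution_family U" and t: "t \<ge> 0" and u: "u \<in> cont_halfline"
  shows "Phi U t u \<in> cont_halfline"
proof -
  have cont: "continuous_on {(t, s). t \<ge> s \<and> s \<ge> 0} (\<lambda>(\<xi>, s). U \<xi> s (u t))"
    using U by (simp add: evolution_family_def)
  have "continuous_on {t..} (\<lambda>\<xi>. case (\<xi>, t) of (\<xi>, s) \<Rightarrow> U \<xi> s (u t))"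
    by (rule continuous_on_compose2[OF cont]) (use t in \<open>auto intro!: continuous_intros\<close>)
  then have right: "continuous_on {t..} (\<lambda>\<xi>. U \<xi> t (u t))"
    by simp
  have left: "continuous_on {0..t} u"
    using u continuous_on_subset[of "{0..}" u "{0..t}"] by (auto simp: cont_halfline_def)
  \<comment> \<open>The two pieces meet only at \<open>t\<close>, where they agree because
    \<open>U t t\<close> is the identity.\<close>
  have "continuous_on ({t..} \<union> {0..t}) (\<lambda>\<xi>. if \<xi> \<ge> t then U \<xi> t (u t) else u \<xi>)"
    by (rule continuous_on_If[OF _ _ right left]) (use evolution_family_id[OF U t] in auto)
  moreover have "{t..} \<union> {0..t} = {0..}"
    using t by auto
  ultimately show ?thesis
    by (simp add: cont_halfline_def Phi_def)
qed

text \<open>For s \<ge> t the cocycle identity turns the term at s into the term of \<open>u\<close>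
  at \<open>t\<close>; for s < t nothing changes. Exponent 0 makes the weights at s and
  \<open>t\<close> equal, so the same constant serves.\<close>

lemma Phi_C_b_zero:
  assumes U: "evolution_family U" and t: "t \<ge> 0" and u: "u \<in> C_b U 0"
  shows "Phi U t u \<in> C_b U 0"
proof -
  obtain K where K: "\<And>s \<tau>. 0 \<le> s \<Longrightarrow> s \<le> \<tau> \<Longrightarrow> norm (U \<tau> s (u s)) \<le> K"
    using u by (auto simp: C_b_iff)
  have "norm (U \<tau> s (Phi U t u s)) \<le> K" if "0 \<le> s" "s \<le> \<tau>" for s \<tau>
    using K[of s \<tau>] K[of t \<tau>] that t by (auto simp: Phi_def evolution_family_apply[OF U])
  then show ?thesis
    using Phi_cont_halfline[OF U t] u by (auto simp: C_b_iff)
qed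

text \<open>From time \<open>t\<close> on, the image follows the orbit of \<open>u t\<close>. Hence
  only the values of \<open>u\<close> on the compact interval [0, t] enter, and there
  \<open>M s * norm (u s)\<close> is bounded.\<close>

lemma stable_Phi_cont_halfline:
  assumes U: "evolution_family U" and stable: "nonuniformly_stable U"
    and t: "t \<ge> 0" and u: "u \<in> cont_halfline"
  shows "Phi U t u \<in> C_b U 0"
proof -
  obtain M where M: "continuous_on {0..} M" "\<And>s. s \<ge> 0 \<Longrightarrow> M s > 0"
      "\<And>\<tau> s. \<tau> \<ge> s \<Longrightarrow> s \<ge> 0 \<Longrightarrow> norm (U \<tau> s) \<le> M s"
    using stable by (auto simp: nonuniformly_stable_def admissible_exponents_def)
  have "continuous_on {0..t} (\<lambda>s. M s * norm (u s))"
    using M(1) u t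
    by (auto simp: cont_halfline_def intro!: continuous_intros intro: continuous_on_subset)
  then obtain B where B: "\<And>s. s \<in> {0..t} \<Longrightarrow> M s * norm (u s) \<le> B"
    by (rule continuous_on_compact_bounded_above[OF compact_Icc]) (rule that)
  have le: "norm (U \<tau> s (u s)) \<le> B" if "0 \<le> s" "s \<le> t" "s \<le> \<tau>" for s \<tau>
  proof -
    have "norm (U \<tau> s (u s)) \<le> norm (U \<tau> s) * norm (u s)"
      by (rule norm_blinfun)
    also have "\<dots> \<le> M s * norm (u s)"
      using M(3) that by (intro mult_right_mono) auto
    finally show ?thesis using B that by force
  qed
  have "norm (U \<tau> s (Phi U t u s)) \<le> B" if "0 \<le> s" "s \<le> \<tau>" for s \<tau>
    using le[of s \<tau>] le[of t \<tau>] that t by (auto simp: Phi_def evolution_family_apply[OF U])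
  then show ?thesis
    using Phi_cont_halfline[OF U t u] by (auto simp: C_b_iff)
qed

section \<open>Compactly supported functions\<close>

lemma cont_compact_support_bounded:
  fixes u :: "real \<Rightarrow> 'a::banach"
  assumes u: "u \<in> cont_compact_support" and M: "continuous_on {0..} M"
  obtains B :: real where "\<And>s. s \<ge> 0 \<Longrightarrow> M s * norm (u s) \<le> B"
proof -
  let ?S = "closure (support_on {0..} u)"
  have "?S \<subseteq> {0..}"
    by (intro closure_minimal) (auto simp: support_on_def)
  then have "continuous_on ?S (\<lambda>s. M s * norm (u s))"
    using M u unfolding cont_compact_support_def cont_halfline_def
    by (auto intro!: continuous_intros intro: continuous_on_subset)
  moreover have "compact ?S"
    using u by (simp add: cont_compact_support_def)
  ultimately obtain B where B: "\<And>s. s \<in> ?S \<Longrightarrow> M s * norm (u s) \<le> B"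
    using continuous_on_compact_bounded_above by blast
  \<comment> \<open>The product is 0 wherever \<open>u\<close> vanishes, while \<open>B\<close>
    might be negative, for instance when the support is empty.\<close>
  have "M s * norm (u s) \<le> max B 0" if "s \<ge> 0" for s
  proof (cases "u s = 0")
    case False
    then have "s \<in> ?S"
      using that closure_subset[of "support_on {0..} u"] by (auto simp: support_on_def)
    then show ?thesis using B by (simp add: le_max_iff_disj)
  qed simp
  then show thesis by (rule that)
qed

text \<open>The weight in \<open>phi\<close> exactly cancels the exponential in the admissible
  bound, leaving \<open>M s * norm (u s)\<close>, which is bounded on the support.\<close>

lemma cont_compact_support_subset_C_b:
  assumes \<alpha>: "\<alpha> \<in> admissible_exponents U"
  shows "cont_compact_support \<subseteq> C_b U \<alpha>"
proof
  fix u :: "real \<Rightarrow> 'a" assume u: "u \<in> cont_compact_support"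
  obtain M where M: "continuous_on {0..} M"
      "\<And>\<tau> s. \<tau> \<ge> s \<Longrightarrow> s \<ge> 0 \<Longrightarrow> norm (U \<tau> s) \<le> M s * exp (\<alpha> * (\<tau> - s))"
    using \<alpha> by (auto simp: admissible_exponents_def)
  obtain B where B: "\<And>s. s \<ge> 0 \<Longrightarrow> M s * norm (u s) \<le> B"
    using cont_compact_support_bounded[OF u M(1)] by blast
  have "exp (- \<alpha> * (\<tau> - s)) * norm (U \<tau> s (u s)) \<le> B" if "0 \<le> s" "s \<le> \<tau>" for s \<tau>
  proof -
    have "norm (U \<tau> s (u s)) \<le> norm (U \<tau> s) * norm (u s)"
      by (rule norm_blinfun)
    also have "\<dots> \<le> M s * exp (\<alpha> * (\<tau> - s)) * norm (u s)"
      using M(2) that by (intro mult_right_mono) auto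
    finally have "exp (- \<alpha> * (\<tau> - s)) * norm (U \<tau> s (u s))
        \<le> exp (- \<alpha> * (\<tau> - s)) * (M s * exp (\<alpha> * (\<tau> - s)) * norm (u s))"
      by (intro mult_left_mono) auto
    also have "\<dots> = M s * norm (u s)"
      by (simp flip: exp_add add: algebra_simps)
    finally show ?thesis using B[OF that(1)] by linarith
  qed
  then show "u \<in> C_b U \<alpha>"
    using u by (auto simp: C_b_iff cont_compact_support_def)
qed

lemma ex_cont_compact_support:
  fixes x :: "'a::banach"
  obtains u where "u \<in> cont_compact_support" "u t = x"
proof
  \<comment> \<open>A tent of height 1 centred at \<open>t\<close>, vanishing outside
    [t - 1, t + 1].\<close>
  let ?u = "\<lambda>s. max 0 (1 - \<bar>s - t\<bar>) *\<^sub>R x"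
  have "support_on {0..} ?u \<subseteq> {t - 1..t + 1}"
    by (auto simp: support_on_def max_def split: if_splits)
  then have "bounded (support_on {0..} ?u)"
    by (rule bounded_subset[rotated]) simp
  then show "?u \<in> cont_compact_support"
    by (auto simp: cont_compact_support_def cont_halfline_def compact_closure
        intro!: continuous_intros)
qed simp

section \<open>Stability from bounded orbits\<close>

text \<open>Uniform boundedness at each s gives a constant with no control on how it varies with s,
  whereas admissibility asks for a continuous bound. So it is invoked only at integers, and the
  continuous \<open>M\<close> bridges the gap from s to the next integer.\<close>

lemma nonuniformly_stableI:
  assumes U: "evolution_family U" and \<alpha>: "\<alpha> \<in> admissible_exponents U"
    and orbits: "\<And>s x. s \<ge> 0 \<Longrightarrow> \<exists>B. \<forall>t\<ge>s. norm (U t s x) \<le> B"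
  shows "nonuniformly_stable U"
proof -
  obtain M where M: "continuous_on {0..} M" "\<And>s. s \<ge> 0 \<Longrightarrow> M s > 0"
      "\<And>t s. t \<ge> s \<Longrightarrow> s \<ge> 0 \<Longrightarrow> norm (U t s) \<le> M s * exp (\<alpha> * (t - s))"
    using \<alpha> by (auto simp: admissible_exponents_def)
  have "\<exists>K\<ge>0. \<forall>t\<ge>s. norm (U t s) \<le> K" if "s \<ge> 0" for s
  proof -
    have "\<exists>B. \<forall>t\<in>{s..}. norm (U t s x) \<le> B" for x
      using orbits[OF that] by (simp add: Ball_def)
    then obtain K where "K \<ge> 0" "\<And>t. t \<in> {s..} \<Longrightarrow> norm (U t s) \<le> K"
      by (rule banach_steinhaus) (rule that)
    then show ?thesis by auto
  qed
  \<comment> \<open>The shift by 1 makes \<open>K n\<close> belong to the right endpoint of [n, n +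
    1), the interval of all s with floor n.\<close>
  then have "\<forall>n. \<exists>K\<ge>0. \<forall>t\<ge>real n + 1. norm (U t (real n + 1)) \<le> K"
    by simp
  then obtain K where K: "\<And>n. K n \<ge> 0"
      "\<And>n t. t \<ge> real n + 1 \<Longrightarrow> norm (U t (real n + 1)) \<le> K n"
    unfolding choice_iff by blast
  \<comment> \<open>Adding 1 makes the factor at least 1, which covers times t up to the next
    integer, and makes \<open>g\<close> strictly positive.\<close>
  have K1: "0 \<le> K n + 1" for n
    using K(1)[of n] by simp
  obtain g :: "real \<Rightarrow> real"
    where g: "continuous_on {0..} g" "\<And>s. s \<ge> 0 \<Longrightarrow> K (nat \<lfloor>s\<rfloor>) + 1 \<le> g s"
    using continuous_above_step_function[of "\<lambda>n. K n + 1", OF K1] by blast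
  let ?M = "\<lambda>s. g s * (M s * exp \<bar>\<alpha>\<bar>)"
  \<comment> \<open>Over a time span of at most 1 the exponential is at most
    \<open>exp \<bar>\<alpha>\<bar>\<close>, whatever the sign of \<alpha>.\<close>
  have short: "norm (U t s) \<le> M s * exp \<bar>\<alpha>\<bar>" if "0 \<le> s" "s \<le> t" "t \<le> s + 1" for t s
  proof -
    have "\<alpha> * (t - s) \<le> \<bar>\<alpha>\<bar> * 1"
      using that by (intro mult_mono) auto
    then have "M s * exp (\<alpha> * (t - s)) \<le> M s * exp \<bar>\<alpha>\<bar>"
      using M(2)[OF that(1)] by simp
    then show ?thesis using M(3)[of s t] that by linarith
  qed
  have "norm (U t s) \<le> ?M s" if s: "0 \<le> s" "s \<le> t" for t s
  proof -
    define n where "n = real (nat \<lfloor>s\<rfloor>) + 1"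
    have n: "s \<le> n" "n \<le> s + 1"
      using s unfolding n_def by linarith+
    have pos: "0 \<le> M s * exp \<bar>\<alpha>\<bar>"
      using M(2)[OF s(1)] by simp
    have "norm (U t s) \<le> (K (nat \<lfloor>s\<rfloor>) + 1) * (M s * exp \<bar>\<alpha>\<bar>)"
    \<comment> \<open>Up to \<open>n\<close> the short-time bound suffices; beyond it,
      \<open>U t s\<close> factors through \<open>n\<close>, with \<open>K\<close> bounding the long
      part and \<open>short\<close> the part from s to \<open>n\<close>.\<close>
    proof (cases "t \<le> n")
      case True
      then have "norm (U t s) \<le> 1 * (M s * exp \<bar>\<alpha>\<bar>)"
        using short[of s t] s n by simp
      also have "\<dots> \<le> (K (nat \<lfloor>s\<rfloor>) + 1) * (M s * exp \<bar>\<alpha>\<bar>)"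
        using K(1) pos by (intro mult_right_mono) auto
      finally show ?thesis .
    next
      case False
      then have "norm (U t s) = norm (U t n o\<^sub>L U n s)"
        using evolution_family_compose[OF U, of n t s] n s by simp
      also have "\<dots> \<le> norm (U t n) * norm (U n s)"
        by (rule norm_blinfun_compose)
      also have "\<dots> \<le> (K (nat \<lfloor>s\<rfloor>) + 1) * (M s * exp \<bar>\<alpha>\<bar>)"
      proof (rule mult_mono)
        have "norm (U t n) \<le> K (nat \<lfloor>s\<rfloor>)"
          using K(2) False unfolding n_def by simp
        then show "norm (U t n) \<le> K (nat \<lfloor>s\<rfloor>) + 1" by simp
        show "norm (U n s) \<le> M s * exp \<bar>\<alpha>\<bar>"
          using short s n by simp
      qed (use K(1)[of "nat \<lfloor>s\<rfloor>"] in auto)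
      finally show ?thesis .
    qed
    also have "\<dots> \<le> ?M s"
      using g(2)[OF s(1)] pos by (rule mult_right_mono)
    finally show ?thesis .
  qed
  moreover have "continuous_on {0..} ?M"
    using g(1) M(1) by (intro continuous_intros)
  moreover have "?M s > 0" if "s \<ge> 0" for s
  proof -
    have "g s > 0"
      using g(2)[OF that] K(1)[of "nat \<lfloor>s\<rfloor>"] by linarith
    then show ?thesis
      using M(2)[OF that] by simp
  qed
  ultimately have "continuous_on {0..} ?M \<and> (\<forall>s\<ge>0. ?M s > 0) \<and>
      (\<forall>t s. t \<ge> s \<and> s \<ge> 0 \<longrightarrow> norm (U t s) \<le> ?M s * exp (0 * (t - s)))"
    by simp
  then show ?thesis
    unfolding nonuniformly_stable_def admissible_exponents_def by blast
qed

section \<open>The equivalences\<close>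

lemma stable_if_Phi_cont_compact_support:
  fixes U :: "real \<Rightarrow> real \<Rightarrow> 'a::banach \<Rightarrow>\<^sub>L 'a"
  assumes U: "evolution_family U" and \<alpha>: "\<alpha> \<in> admissible_exponents U"
    and Phi: "\<And>t. t \<ge> 0 \<Longrightarrow> Phi U t ` cont_compact_support \<subseteq> C_b U \<alpha>"
  shows "nonuniformly_stable U"
proof (rule nonuniformly_stableI[OF U \<alpha>])
  fix s :: real and x :: 'a assume s: "s \<ge> 0"
  obtain u where u: "u \<in> cont_compact_support" "u s = x"
    using ex_cont_compact_support .
  then have "Phi U s u \<in> C_b U \<alpha>"
    using Phi[OF s] by blast
  then obtain B where B: "\<And>t \<tau>. t \<ge> 0 \<Longrightarrow> \<tau> \<ge> t \<Longrightarrow>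
      exp (- \<alpha> * (\<tau> - t)) * norm (U \<tau> t (Phi U s u t)) \<le> B"
    by (auto simp: C_b_iff)
  \<comment> \<open>On the diagonal the weight is 1 and \<open>U t t\<close> is the identity, so
    \<alpha> disappears from the bound.\<close>
  have "norm (U t s x) \<le> B" if "t \<ge> s" for t
    using B[of t t] that s u(2) evolution_family_id[OF U, of t] by (simp add: Phi_def)
  then show "\<exists>B. \<forall>t\<ge>s. norm (U t s x) \<le> B" by blast
qed

theorem theorem3p1:
  fixes U :: "real \<Rightarrow> real \<Rightarrow> 'a::banach \<Rightarrow>\<^sub>L 'a"
  assumes "evolution_family U"
    and "nonuniform_exp_bounded U"
  shows "(nonuniformly_stable U \<longleftrightarrow>
            (\<exists>\<alpha>\<in>admissible_exponents U. \<forall>t\<ge>0. Phi U t ` C_b U \<alpha> \<subseteq> C_b U \<alpha>)) \<and>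
         (nonuniformly_stable U \<longleftrightarrow>
            (\<exists>\<alpha>\<in>admissible_exponents U. \<forall>t\<ge>0. Phi U t ` cont_compact_support \<subseteq> C_b U \<alpha>))"
proof (intro conjI iffI)
  assume stable: "nonuniformly_stable U"
  then have zero: "0 \<in> admissible_exponents U"
    by (simp add: nonuniformly_stable_def)
  show "\<exists>\<alpha>\<in>admissible_exponents U. \<forall>t\<ge>0. Phi U t ` C_b U \<alpha> \<subseteq> C_b U \<alpha>"
    using zero Phi_C_b_zero[OF assms(1)] by blast
  show "\<exists>\<alpha>\<in>admissible_exponents U. \<forall>t\<ge>0. Phi U t ` cont_compact_support \<subseteq> C_b U \<alpha>"
    using zero stable_Phi_cont_halfline[OF assms(1) stable]
    by (intro bexI[of _ 0]) (auto simp: cont_compact_support_def)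
next
  assume "\<exists>\<alpha>\<in>admissible_exponents U. \<forall>t\<ge>0. Phi U t ` cont_compact_support \<subseteq> C_b U \<alpha>"
  then show "nonuniformly_stable U"
    using stable_if_Phi_cont_compact_support[OF assms(1)] by blast
next
  assume "\<exists>\<alpha>\<in>admissible_exponents U. \<forall>t\<ge>0. Phi U t ` C_b U \<alpha> \<subseteq> C_b U \<alpha>"
  then obtain \<alpha> where \<alpha>: "\<alpha> \<in> admissible_exponents U"
      and inv: "\<And>t. t \<ge> 0 \<Longrightarrow> Phi U t ` C_b U \<alpha> \<subseteq> C_b U \<alpha>"
    by blast
  have "Phi U t ` cont_compact_support \<subseteq> C_b U \<alpha>" if "t \<ge> 0" for t
    using cont_compact_support_subset_C_b[OF \<alpha>] inv[OF that] by blast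
  then show "nonuniformly_stable U"
    by (rule stable_if_Phi_cont_compact_support[OF assms(1) \<alpha>])
qed

end
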